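(* Let $\alpha>0$, let $(\bar x,\bar u)\in\mathbb{R}^{n_x}\times\mathbb{R}^{n_u}$ be a nominal state-control pair, and let $\delta x=x-\bar x$, $\delta u=u-\bar u$. Consider the approximated maximum entropy Bellman equation $$V(x)=\inf_\pi\Big\{\mathbb{E}_{\delta u\sim\pi(\cdot|\delta x)}\big[\hat Q(\delta x,\delta u)\big]-\alpha H[\pi(\cdot|\delta x)]\Big\},$$ where $\hat Q$ is the quadratic approximation of $Q=V'(f(x,u))+l(x,u)$ around $(\bar x,\bar u)$, $$\hat Q(\delta x,\delta u)=\bar V'+l(\bar x,\bar u)+Q_x^{\mathrm T}\delta x+Q_u^{\mathrm T}\delta u+\tfrac12\delta x^{\mathrm T}Q_{xx}\delta x+\delta u^{\mathrm T}Q_{ux}\delta x+\tfrac12\delta u^{\mathrm T}Q_{uu}\delta u,$$ with $Q_{uu}$ symmetric positive definite. Then the optimal policy is Gaussian with mean $\delta u^*$ and covariance $\alpha Q_{uu}^{-1}$, $$\pi^*(\delta u|\delta x)=\mathcal N(\delta u;\,\delta u^*,\,\alpha Q_{uu}^{-1}),$$ where $$\delta u^*=-Q_{uu}^{-1}(Q_{ux}\delta x+Q_u)=K\delta x+k,\qquad K=-Q_{uu}^{-1}Q_{ux},\quad k=-Q_{uu}^{-1}Q_u.$$ Consequently the value function has the form $$V(x)=\bar V(\bar x)+V_H(\bar x)+V_x(\bar x)^{\mathrm T}\delta x+\tfrac12\delta x^{\mathrm T}V_{xx}(\bar x)\delta x,$$ where $$\bar V(\bar x)=\bar V'+l(\bar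 x,\bar u)-\tfrac12Q_u^{\mathrm T}Q_{uu}^{-1}Q_u,$$ $$V_H(\bar x)=\tfrac{\alpha}{2}\big(\ln|Q_{uu}|-n_u\ln(2\pi\alpha)\big),$$ $$V_x(\bar x)=Q_x+K^{\mathrm T}Q_{uu}k+K^{\mathrm T}Q_u+Q_{ux}^{\mathrm T}k,$$ $$V_{xx}(\bar x)=Q_{xx}+K^{\mathrm T}Q_{uu}K+K^{\mathrm T}Q_{ux}+Q_{ux}^{\mathrm T}K.$$
   Context: This is one backward-pass step of maximum entropy Differential Dynamic Programming. $f$ is the dynamics, $l$ the running cost, and $V'$ the value function at the next timestep (not a derivative), taken to be quadratic around the next nominal state $f(\bar x,\bar u)$, with value $\bar V'=V'(f(\bar x,\bar u))$, gradient $V'_x$ and symmetric Hessian $V'_{xx}$ there. The cost $l$ is replaced by its second-order Taylor expansion at $(\bar x,\bar u)$ with derivatives $l_x,l_u,l_{xx},l_{ux}=l_{xu}^{\mathrm T},l_{uu}$, and the dynamics by the first-order expansion $f(x,u)\approx f(\bar x,\bar u)+f_x^{\mathrm T}\delta x+f_u^{\mathrm T}\delta u$ (so $f_x^{\mathrm T},f_u^{\mathrm T}$ are the Jacobians). The subscripted $Q$ denote partial derivatives at $(\bar x,\bar u)$ under these approximations: $$Q_x=l_x+f_xV'_x,\quad Q_u=l_u+f_uV'_x,\quad Q_{xx}=l_{xx}+f_xV'_{xx}f_x^{\mathrm T},$$ $$Q_{ux}=Q_{xu}^{\mathrm T}=l_{ux}+f_uV'_{xx}f_x^{\mathrm T},\quad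 Q_{uu}=l_{uu}+f_uV'_{xx}f_u^{\mathrm T}.$$ For fixed $\delta x$, a policy $\pi(\cdot|\delta x)$ is a probability density on $\mathbb{R}^{n_u}$; the infimum is over all such densities. $H[\pi]=-\int\pi\ln\pi$ is the Shannon (differential) entropy, and the objective is understood as the single integral $\int\pi\,(\hat Q+\alpha\ln\pi)$. $\mathcal N(\cdot;\mu,\Sigma)$ is the Gaussian density with mean $\mu$ and covariance $\Sigma$, and $|\cdot|$ is the determinant. *)

theory Defs
  imports "HOL-Analysis.Analysis"
begin

section \<open>Gradients, Hessians and quadratic models\<close>

definition grad :: "('a::real_inner \<Rightarrow> real) \<Rightarrow> 'a \<Rightarrow> 'a" where
  "grad g a = (THE D. GDERIV g a :> D)"

definition hess :: "(real^'a \<Rightarrow> real) \<Rightarrow> real^'a \<Rightarrow> real^'a^'a" where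
  "hess g a = jacobian (grad g) (at a)"

definition twice_differentiable_at :: "('a::real_inner \<Rightarrow> real) \<Rightarrow> 'a \<Rightarrow> bool" where
  "twice_differentiable_at g a \<longleftrightarrow>
     (\<forall>\<^sub>F y in nhds a. g differentiable (at y)) \<and> grad g differentiable (at a)"

definition quadratic_around :: "(real^'a \<Rightarrow> real) \<Rightarrow> real^'a \<Rightarrow> bool" where
  "quadratic_around g a \<longleftrightarrow>
     transpose (hess g a) = hess g a \<and>
     (\<forall>z. g z = g a + grad g a \<bullet> (z - a) + 1/2 * ((z - a) \<bullet> (hess g a *v (z - a))))"

definition sym_pos_def :: "real^'a^'a \<Rightarrow> bool" where
  "sym_pos_def A \<longleftrightarrow> transpose A = A \<and> (\<forall>v. v \<noteq> 0 \<longrightarrow> v \<bullet> (A *v v) > 0)"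

lemma grad_eqI:
  assumes "GDERIV g a :> D"
  shows "grad g a = D"
  unfolding grad_def
proof (rule the_equality)
  show "GDERIV g a :> D" by (rule assms)
next
  fix E assume "GDERIV g a :> E"
  then have "(\<lambda>h. h \<bullet> E) = (\<lambda>h. h \<bullet> D)"
    using assms has_derivative_unique unfolding gderiv_def by blast
  then show "E = D"
    by (metis vector_eq_ldot)
qed

lemma quadratic_grad_hess:
  fixes H :: "real^'a^'a" and b :: "real^'a"
  assumes sym: "transpose H = H"
    and g: "\<And>z. g z = c + b \<bullet> (z - a) + 1/2 * ((z - a) \<bullet> (H *v (z - a)))"
  shows "grad g a = b" "hess g a = H" "quadratic_around g a"
proof -
  have inner_sym: "y \<bullet> (H *v h) = h \<bullet> (H *v y)" for y h
    by (metis dot_lmul_matrix inner_commute sym transpose_matrix_vector)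
  have deriv: "GDERIV g z :> (b + H *v (z - a))" for z
  proof -
    have g': "g = (\<lambda>z. c + b \<bullet> (z - a) + 1/2 * ((z - a) \<bullet> (H *v (z - a))))"
      using g by auto
    have d: "((\<lambda>z. z - a) has_derivative (\<lambda>h. h)) (at z)"
      by (auto intro!: derivative_eq_intros)
    have H: "((\<lambda>z. H *v (z - a)) has_derivative (\<lambda>h. H *v h)) (at z)"
      by (rule bounded_linear.has_derivative[OF matrix_vector_mul_bounded_linear d])
    have "((\<lambda>z. c + b \<bullet> (z - a) + 1/2 * ((z - a) \<bullet> (H *v (z - a)))) has_derivative
        (\<lambda>h. 0 + b \<bullet> h + 1/2 * ((z - a) \<bullet> (H *v h) + h \<bullet> (H *v (z - a))))) (at z)"
      by (intro has_derivative_add has_derivative_const has_derivative_inner_right[OF d]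
          has_derivative_mult_right has_derivative_inner[OF d H])
    moreover have "(\<lambda>h. 0 + b \<bullet> h + 1/2 * ((z - a) \<bullet> (H *v h) + h \<bullet> (H *v (z - a))))
        = (\<lambda>h. h \<bullet> (b + H *v (z - a)))"
      by (simp add: fun_eq_iff inner_sym[of "z - a"] inner_add_right inner_commute[of b])
    ultimately show ?thesis
      unfolding gderiv_def g' by simp
  qed
  then have grad: "grad g = (\<lambda>z. b + H *v (z - a))"
    by (auto intro: grad_eqI)
  show 1: "grad g a = b"
    by (simp add: grad)
  have "((\<lambda>z. b + H *v (z - a)) has_derivative (\<lambda>h. 0 + H *v h)) (at a)"
    by (intro has_derivative_add has_derivative_const
        bounded_linear.has_derivative[OF matrix_vector_mul_bounded_linear])
      (auto intro!: derivative_eq_intros)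
  then have "frechet_derivative (grad g) (at a) = (\<lambda>h. H *v h)"
    unfolding grad by (simp add: frechet_derivative_at[symmetric])
  then show 2: "hess g a = H"
    by (simp add: hess_def jacobian_def)
  have "g a = c"
    by (simp add: g)
  then show "quadratic_around g a"
    unfolding quadratic_around_def 1 2 using sym g by metis
qed


section \<open>The quadratic approximation of the state-action value\<close>

text \<open>The matrices \<open>dyn_x\<close> and \<open>dyn_u\<close> are the \<^emph>\<open>transposed\<close> Jacobians of the dynamics.\<close>

definition dyn_x :: "(real^'n \<Rightarrow> real^'m \<Rightarrow> real^'n) \<Rightarrow> real^'n \<Rightarrow> real^'m \<Rightarrow> real^'n^'n" where
  "dyn_x f xb ub = transpose (jacobian (\<lambda>x. f x ub) (at xb))"

definition dyn_u :: "(real^'n \<Rightarrow> real^'m \<Rightarrow> real^'n) \<Rightarrow> real^'n \<Rightarrow> real^'m \<Rightarrow> real^'n^'m" where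
  "dyn_u f xb ub = transpose (jacobian (\<lambda>u. f xb u) (at ub))"

definition cost_x :: "(real^'n \<Rightarrow> real^'m \<Rightarrow> real) \<Rightarrow> real^'n \<Rightarrow> real^'m \<Rightarrow> real^'n" where
  "cost_x l xb ub = grad (\<lambda>x. l x ub) xb"

definition cost_u :: "(real^'n \<Rightarrow> real^'m \<Rightarrow> real) \<Rightarrow> real^'n \<Rightarrow> real^'m \<Rightarrow> real^'m" where
  "cost_u l xb ub = grad (\<lambda>u. l xb u) ub"

definition cost_xx :: "(real^'n \<Rightarrow> real^'m \<Rightarrow> real) \<Rightarrow> real^'n \<Rightarrow> real^'m \<Rightarrow> real^'n^'n" where
  "cost_xx l xb ub = hess (\<lambda>x. l x ub) xb"

definition cost_ux :: "(real^'n \<Rightarrow> real^'m \<Rightarrow> real) \<Rightarrow> real^'n \<Rightarrow> real^'m \<Rightarrow> real^'n^'m" where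
  "cost_ux l xb ub = jacobian (\<lambda>x. cost_u l x ub) (at xb)"

definition cost_uu :: "(real^'n \<Rightarrow> real^'m \<Rightarrow> real) \<Rightarrow> real^'n \<Rightarrow> real^'m \<Rightarrow> real^'m^'m" where
  "cost_uu l xb ub = hess (\<lambda>u. l xb u) ub"

text \<open>
  In the following, \<open>W\<close> is the value function of the next timestep; its gradient and Hessian are
  taken at the next nominal state \<open>f xb ub\<close>.
\<close>

definition Qx where
  "Qx f l W xb ub = cost_x l xb ub + dyn_x f xb ub *v grad W (f xb ub)"

definition Qu where
  "Qu f l W xb ub = cost_u l xb ub + dyn_u f xb ub *v grad W (f xb ub)"

definition Qxx where
  "Qxx f l W xb ub =
     cost_xx l xb ub + dyn_x f xb ub ** hess W (f xb ub) ** transpose (dyn_x f xb ub)"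

definition Qux where
  "Qux f l W xb ub =
     cost_ux l xb ub + dyn_u f xb ub ** hess W (f xb ub) ** transpose (dyn_x f xb ub)"

definition Quu where
  "Quu f l W xb ub =
     cost_uu l xb ub + dyn_u f xb ub ** hess W (f xb ub) ** transpose (dyn_u f xb ub)"

definition Qhat ::
  "(real^'n \<Rightarrow> real^'m \<Rightarrow> real^'n) \<Rightarrow> (real^'n \<Rightarrow> real^'m \<Rightarrow> real) \<Rightarrow> (real^'n \<Rightarrow> real) \<Rightarrow>
   real^'n \<Rightarrow> real^'m \<Rightarrow> real^'n \<Rightarrow> real^'m \<Rightarrow> real"
where
  "Qhat f l W xb ub dx du =
     W (f xb ub) + l xb ub + Qx f l W xb ub \<bullet> dx + Qu f l W xb ub \<bullet> du
     + 1/2 * (dx \<bullet> (Qxx f l W xb ub *v dx)) + du \<bullet> (Qux f l W xb ub *v dx)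
     + 1/2 * (du \<bullet> (Quu f l W xb ub *v du))"

text \<open>
  \<open>Qhat\<close> is what results from \<open>W (f x u) + l x u\<close> by linearising the dynamics and replacing the
  cost by its second-order Taylor polynomial.
\<close>

lemma Qhat_eq_approximation:
  assumes "quadratic_around W (f xb ub)"
  shows "Qhat f l W xb ub dx du =
     W (f xb ub + transpose (dyn_x f xb ub) *v dx + transpose (dyn_u f xb ub) *v du)
     + (l xb ub + cost_x l xb ub \<bullet> dx + cost_u l xb ub \<bullet> du
        + 1/2 * (dx \<bullet> (cost_xx l xb ub *v dx)) + du \<bullet> (cost_ux l xb ub *v dx)
        + 1/2 * (du \<bullet> (cost_uu l xb ub *v du)))"
proof -
  define H where "H = hess W (f xb ub)"
  define b where "b = grad W (f xb ub)"
  define p where "p = transpose (dyn_x f xb ub) *v dx"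
  define q where "q = transpose (dyn_u f xb ub) *v du"
  have sym: "transpose H = H"
    using assms unfolding quadratic_around_def H_def by blast
  have W: "W (f xb ub + z) = W (f xb ub) + b \<bullet> z + 1/2 * (z \<bullet> (H *v z))" for z
  proof -
    have "W y = W (f xb ub) + b \<bullet> (y - f xb ub) + 1/2 * ((y - f xb ub) \<bullet> (H *v (y - f xb ub)))" for y
      using assms unfolding quadratic_around_def H_def b_def by blast
    from this[of "f xb ub + z"] show ?thesis
      by (simp only: add_diff_cancel_left')
  qed
  have adj: "v \<bullet> (A *v w) = (transpose A *v v) \<bullet> w" for A :: "real^'c^'d" and v w
    by (simp add: dot_lmul_matrix transpose_matrix_vector)
  have "p \<bullet> (H *v q) = q \<bullet> (H *v p)"
    by (metis adj inner_commute sym)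
  then have "W (f xb ub + p + q) = W (f xb ub) + b \<bullet> p + b \<bullet> q
      + 1/2 * (p \<bullet> (H *v p)) + q \<bullet> (H *v p) + 1/2 * (q \<bullet> (H *v q))"
    by (simp add: add.assoc W) (simp add: inner_add_left inner_add_right
        matrix_vector_right_distrib algebra_simps)
  moreover have "(dyn_x f xb ub *v b) \<bullet> dx = b \<bullet> p" "(dyn_u f xb ub *v b) \<bullet> du = b \<bullet> q"
    unfolding p_def q_def by (metis adj transpose_transpose)+
  moreover have "dx \<bullet> (dyn_x f xb ub ** H ** transpose (dyn_x f xb ub) *v dx) = p \<bullet> (H *v p)"
    "du \<bullet> (dyn_u f xb ub ** H ** transpose (dyn_x f xb ub) *v dx) = q \<bullet> (H *v p)"
    "du \<bullet> (dyn_u f xb ub ** H ** transpose (dyn_u f xb ub) *v du) = q \<bullet> (H *v q)"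
    unfolding p_def q_def by (simp_all only: adj matrix_vector_mul_assoc[symmetric])
  ultimately show ?thesis
    unfolding Qhat_def Qx_def Qu_def Qxx_def Qux_def Quu_def
    unfolding H_def[symmetric] b_def[symmetric] p_def[symmetric] q_def[symmetric]
    by (simp add: inner_add_left inner_add_right matrix_vector_mult_add_rdistrib algebra_simps)
qed


section \<open>Maximum entropy objective\<close>

definition prob_densities :: "('a::euclidean_space \<Rightarrow> real) set" where
  "prob_densities =
     {\<pi>. \<pi> \<in> borel_measurable lborel \<and> (\<forall>u. 0 \<le> \<pi> u) \<and> (\<integral>\<^sup>+u. ennreal (\<pi> u) \<partial>lborel) = 1}"

text \<open>
  The Lebesgue integral with values in the extended reals. It is the intended value as soon as the
  positive or the negative part has a finite integral.
\<close>

definition ext_integral :: "'a measure \<Rightarrow> ('a \<Rightarrow> real) \<Rightarrow> ereal" where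
  "ext_integral M h =
     enn2ereal (\<integral>\<^sup>+u. ennreal (h u) \<partial>M) - enn2ereal (\<integral>\<^sup>+u. ennreal (- h u) \<partial>M)"

text \<open>
  Expected cost minus \<open>\<alpha>\<close> times the differential entropy, as a single integral. For the
  densities below and a quadratic cost that is positive definite in the control, the negative part
  is always integrable. Where \<open>\<pi> u = 0\<close>, the integrand vanishes.
\<close>

definition max_ent_objective ::
  "real \<Rightarrow> ('a::euclidean_space \<Rightarrow> real) \<Rightarrow> ('a \<Rightarrow> real) \<Rightarrow> ereal"
where
  "max_ent_objective \<alpha> q \<pi> = ext_integral lborel (\<lambda>u. \<pi> u * (q u + \<alpha> * ln (\<pi> u)))"

definition optimal_density ::
  "real \<Rightarrow> ('a::euclidean_space \<Rightarrow> real) \<Rightarrow> ('a \<Rightarrow> real) \<Rightarrow> bool"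
where
  "optimal_density \<alpha> q \<pi> \<longleftrightarrow> \<pi> \<in> prob_densities \<and>
     (\<forall>\<rho>\<in>prob_densities. max_ent_objective \<alpha> q \<pi> \<le> max_ent_objective \<alpha> q \<rho>)"

definition max_ent_value ::
  "(real^'n \<Rightarrow> real^'m \<Rightarrow> real^'n) \<Rightarrow> (real^'n \<Rightarrow> real^'m \<Rightarrow> real) \<Rightarrow> (real^'n \<Rightarrow> real) \<Rightarrow>
   real^'n \<Rightarrow> real^'m \<Rightarrow> real \<Rightarrow> real^'n \<Rightarrow> ereal"
where
  "max_ent_value f l W xb ub \<alpha> x =
     (INF \<pi>\<in>prob_densities. max_ent_objective \<alpha> (Qhat f l W xb ub (x - xb)) \<pi>)"

definition gaussian_density :: "real^'a \<Rightarrow> real^'a^'a \<Rightarrow> real^'a \<Rightarrow> real" where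
  "gaussian_density \<mu> \<Sigma> u =
     exp (- 1/2 * ((u - \<mu>) \<bullet> (matrix_inv \<Sigma> *v (u - \<mu>)))) / sqrt ((2 * pi) ^ CARD('a) * det \<Sigma>)"

lemma ext_integral_eq_lebesgue_integral:
  assumes "integrable M h"
  shows "ext_integral M h = ereal (\<integral>u. h u \<partial>M)"
proof -
  have "(\<integral>\<^sup>+u. ennreal (h u) \<partial>M) < \<infinity>" "(\<integral>\<^sup>+u. ennreal (- h u) \<partial>M) < \<infinity>"
    using assms by (auto simp: real_integrable_def less_top)
  moreover from this have "enn2ereal (\<integral>\<^sup>+u. ennreal (h u) \<partial>M) = ereal (enn2real (\<integral>\<^sup>+u. ennreal (h u) \<partial>M))"
    "enn2ereal (\<integral>\<^sup>+u. ennreal (- h u) \<partial>M) = ereal (enn2real (\<integral>\<^sup>+u. ennreal (- h u) \<partial>M))"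
    by (metis enn2ereal_ennreal enn2real_nonneg ennreal_enn2real infinity_ennreal_def)+
  ultimately show ?thesis
    by (simp add: ext_integral_def real_lebesgue_integral_def[OF assms])
qed

lemma max_ent_objective_eq:
  assumes "integrable lborel (\<lambda>u. \<pi> u * q u)" "integrable lborel (\<lambda>u. \<pi> u * ln (\<pi> u))"
  shows "max_ent_objective \<alpha> q \<pi> =
     ereal ((\<integral>u. \<pi> u * q u \<partial>lborel) - \<alpha> * - (\<integral>u. \<pi> u * ln (\<pi> u) \<partial>lborel))"
proof -
  have eq: "(\<lambda>u. \<pi> u * (q u + \<alpha> * ln (\<pi> u))) = (\<lambda>u. \<pi> u * q u + \<alpha> * (\<pi> u * ln (\<pi> u)))"
    by (simp add: algebra_simps)
  show ?thesis
    unfolding max_ent_objective_def eq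
    by (subst ext_integral_eq_lebesgue_integral) (use assms in auto)
qed

end

theory Submission
  imports Defs "HOL-Probability.Distributions"
begin

text \<open>
  Completing the square in \<open>u\<close> shows that \<open>q + \<alpha> ln g\<close> is a constant \<open>c\<close> for the claimed Gaussian
  \<open>g\<close>. For any density \<open>\<pi>\<close> the integrand of the objective is then
  \<open>c \<pi> + \<alpha> \<pi> ln (\<pi> / g) \<ge> c \<pi> + \<alpha> (\<pi> - g)\<close>, whose right-hand side integrates to \<open>c\<close>. So \<open>c\<close> is the
  value, and equality forces \<open>\<pi> = g\<close> almost everywhere. The Gaussian integral is reduced to the
  standard one by a linear substitution \<open>P\<close> with \<open>P\<^sup>T A P = 1\<close>.
\<close>

section \<open>Linear change of variables for Lebesgue measure\<close>

text \<open>By Fubini the integral can be taken first along the lines parallel to \<open>e\<close>.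
  On each such line \<open>\<phi>\<close> is constant, so the shear acts there as a translation,
  which preserves one-dimensional Lebesgue measure.\<close>

lemma nn_integral_lborel_shear:
  fixes g :: "'a::euclidean_space \<Rightarrow> ennreal" and \<phi> :: "'a \<Rightarrow> real"
  assumes [measurable]: "g \<in> borel_measurable borel" "\<phi> \<in> borel_measurable borel"
    and e: "e \<in> Basis" and \<phi>: "\<And>x t. \<phi> (x + t *\<^sub>R e) = \<phi> x"
  shows "(\<integral>\<^sup>+x. g (x + \<phi> x *\<^sub>R e) \<partial>lborel) = (\<integral>\<^sup>+x. g x \<partial>lborel)"
proof -
  interpret product_sigma_finite "\<lambda>_::'a. lborel :: real measure" ..
  define B where "B = Basis - {e}"
  have B: "finite B" "e \<notin> B" "Basis = insert e B"
    using e by (auto simp: B_def)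
  \<comment> \<open>\<open>s y\<close> is the point of the hyperplane orthogonal to \<open>e\<close>
    with coordinates \<open>y\<close>; every point of the space is uniquely
    \<open>s y + t *\<^sub>R e\<close>.\<close>
  define s where "s y = (\<Sum>b\<in>B. y b *\<^sub>R b)" for y :: "'a \<Rightarrow> real"
  have split: "(\<integral>\<^sup>+x. k x \<partial>lborel) =
      (\<integral>\<^sup>+y. (\<integral>\<^sup>+t. k (s y + t *\<^sub>R e) \<partial>lborel) \<partial>Pi\<^sub>M B (\<lambda>_. lborel))"
    if [measurable]: "k \<in> borel_measurable borel" for k :: "'a \<Rightarrow> ennreal"
  proof -
    have sum_upd: "(\<Sum>b\<in>insert e B. (y(e := t)) b *\<^sub>R b) = s y + t *\<^sub>R e" for y t
    proof -
      have "(\<Sum>b\<in>B. (y(e := t)) b *\<^sub>R b) = s y"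
        unfolding s_def using B(2) by (intro sum.cong) auto
      then show ?thesis using B(1,2) by (simp add: add.commute)
    qed
    have "(\<integral>\<^sup>+x. k x \<partial>lborel) =
        (\<integral>\<^sup>+y. k (\<Sum>b\<in>Basis. y b *\<^sub>R b) \<partial>Pi\<^sub>M Basis (\<lambda>_. lborel))"
      by (subst lborel_eq) (simp add: nn_integral_distr)
    also have "\<dots> = (\<integral>\<^sup>+y. k (\<Sum>b\<in>insert e B. y b *\<^sub>R b) \<partial>Pi\<^sub>M (insert e B) (\<lambda>_. lborel))"
      by (simp only: B(3))
    also have "\<dots> = (\<integral>\<^sup>+y. (\<integral>\<^sup>+t. k (\<Sum>b\<in>insert e B. (y(e := t)) b *\<^sub>R b) \<partial>lborel) \<partial>Pi\<^sub>M B (\<lambda>_. lborel))"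
      using B(1,2) by (intro product_nn_integral_insert) auto
    finally show ?thesis
      by (simp only: sum_upd)
  qed
  have "(\<integral>\<^sup>+t. g (s y + t *\<^sub>R e + \<phi> (s y + t *\<^sub>R e) *\<^sub>R e) \<partial>lborel) =
      (\<integral>\<^sup>+t. g (s y + t *\<^sub>R e) \<partial>lborel)" for y
  proof -
    \<comment> \<open>The inner integral is shifted by \<open>\<phi> (s y)\<close>, which equals the
      value of \<open>\<phi>\<close> at every point of the line.\<close>
    have "(\<integral>\<^sup>+t. g (s y + t *\<^sub>R e) \<partial>lborel) =
        (\<integral>\<^sup>+t. g (s y + t *\<^sub>R e) \<partial>distr lborel borel ((+) (\<phi> (s y))))"
      by (simp only: lborel_distr_plus)
    also have "\<dots> = (\<integral>\<^sup>+t. g (s y + (\<phi> (s y) + t) *\<^sub>R e) \<partial>lborel)"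
      by (subst nn_integral_distr) simp_all
    finally show ?thesis
      by (simp add: \<phi> algebra_simps)
  qed
  then show ?thesis
    by (simp add: split)
qed

lemma Basis_cart: "(Basis :: (real^'n) set) = range (\<lambda>i. axis i 1)" "inj (\<lambda>i. axis i (1::real) :: real^'n)"
  by (auto simp: Basis_vec_def inj_def axis_eq_axis)

text \<open>Lebesgue measure is determined by its values on boxes. Exchanging two coordinates turns
  a box into a box with the same side lengths in another order, hence of the same volume.\<close>

lemma nn_integral_lborel_swap:
  fixes g :: "real^'n \<Rightarrow> ennreal"
  assumes [measurable]: "g \<in> borel_measurable borel"
  shows "(\<integral>\<^sup>+x. g (\<chi> i. x $ Transposition.transpose m n i) \<partial>lborel) = (\<integral>\<^sup>+x. g x \<partial>lborel)"
proof -
  define \<tau> where "\<tau> = Transposition.transpose m n"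
  define T :: "real^'n \<Rightarrow> real^'n" where "T x = (\<chi> i. x $ \<tau> i)" for x
  have \<tau>: "\<tau> (\<tau> i) = i" for i
    by (simp add: \<tau>_def)
  have bij: "bij \<tau>"
    by (simp add: \<tau>_def)
  have [measurable]: "T \<in> borel \<rightarrow>\<^sub>M borel"
    unfolding T_def by (intro borel_measurable_continuous_onI continuous_intros)
  have "lborel = distr lborel borel T"
  proof (rule lborel_eqI)
    fix l u :: "real^'n" assume le: "\<And>b. b \<in> Basis \<Longrightarrow> l \<bullet> b \<le> u \<bullet> b"
    then have le': "l $ i \<le> u $ i" for i
      using le[of "axis i 1"] by (simp add: inner_axis)
    \<comment> \<open>\<open>\<tau>\<close> is an involution, so the preimage of a box under
      \<open>T\<close> is also its image.\<close>
    have "T -` box l u = box (T l) (T u)"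
      unfolding T_def by (auto simp: mem_box_cart) (metis \<tau>)+
    then have "emeasure (distr lborel borel T) (box l u) = emeasure lborel (box (T l) (T u))"
      by (simp add: emeasure_distr)
    also have "\<dots> = ennreal (\<Prod>b\<in>Basis. (T u - T l) \<bullet> b)"
      using le' by (intro emeasure_lborel_box) (auto simp: Basis_cart inner_axis T_def)
    also have "(\<Prod>b\<in>Basis. (T u - T l) \<bullet> b) = (\<Prod>i\<in>UNIV. u $ \<tau> i - l $ \<tau> i)"
      by (simp add: Basis_cart prod.reindex inner_axis T_def)
    also have "\<dots> = (\<Prod>i\<in>UNIV. u $ i - l $ i)"
      by (rule prod.reindex_bij_betw[OF bij])
    also have "\<dots> = (\<Prod>b\<in>Basis. (u - l) \<bullet> b)"
      by (simp add: Basis_cart prod.reindex inner_axis)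
    finally show "emeasure (distr lborel borel T) (box l u) = (\<Prod>b\<in>Basis. (u - l) \<bullet> b)" .
  qed simp
  then have "(\<integral>\<^sup>+x. g x \<partial>lborel) = (\<integral>\<^sup>+x. g x \<partial>distr lborel borel T)"
    by simp
  also have "\<dots> = (\<integral>\<^sup>+x. g (T x) \<partial>lborel)"
    by (rule nn_integral_distr) simp_all
  finally show ?thesis
    by (simp add: T_def \<tau>_def)
qed

text \<open>The library's linear change of variables requires a well-ordered index type.\<close>

lemma nn_integral_lborel_linear:
  fixes A :: "real^'n^'n" and g :: "real^'n \<Rightarrow> ennreal"
  assumes "det A \<noteq> 0" and "g \<in> borel_measurable borel"
  shows "(\<integral>\<^sup>+x. g x \<partial>lborel) = ennreal \<bar>det A\<bar> * (\<integral>\<^sup>+x. g (A *v x) \<partial>lborel)"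
  using assms
proof (induction A arbitrary: g rule: induct_matrix_elementary)
  \<comment> \<open>Products: the hypothesis for \<open>A\<close> is applied to \<open>g\<close>,
    the one for \<open>B\<close> to \<open>g\<close> composed with \<open>A\<close>, and the
    determinants multiply.\<close>
  case (1 A B)
  have [measurable]: "g \<in> borel_measurable borel" by fact
  have "(*v) A \<in> borel \<rightarrow>\<^sub>M borel"
    by (intro borel_measurable_continuous_onI continuous_intros)
  then have gA: "(\<lambda>x. g (A *v x)) \<in> borel_measurable borel"
    by measurable
  have "det A \<noteq> 0" "det B \<noteq> 0"
    using 1(3) by (simp_all add: det_mul)
  then have "(\<integral>\<^sup>+x. g x \<partial>lborel) =
      ennreal \<bar>det A\<bar> * (ennreal \<bar>det B\<bar> * (\<integral>\<^sup>+x. g (A *v (B *v x)) \<partial>lborel))"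
    using 1(1)[of g] 1(2)[OF _ gA] by simp
  then show ?case
    by (simp add: det_mul abs_mult ennreal_mult matrix_vector_mul_assoc mult.assoc)
next
  \<comment> \<open>A zero row makes the determinant vanish, against the assumption.\<close>
  case (2 A i)
  then show ?case
    by (simp add: det_zero_row)
next
  case (3 A)
  have [measurable]: "g \<in> borel_measurable borel" by fact
  have [measurable]: "(*v) A \<in> borel \<rightarrow>\<^sub>M borel"
    by (intro borel_measurable_continuous_onI continuous_intros)
  have det: "det A = (\<Prod>i\<in>UNIV. A $ i $ i)"
    using 3 by (intro det_diagonal) auto
  have nz: "A $ i $ i \<noteq> 0" for i
    using 3(2) unfolding det by simp
  \<comment> \<open>The affine substitution rule takes scaling factors indexed by basis vectors;
    \<open>c\<close> reads the diagonal of \<open>A\<close> in that form.\<close>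
  define c where "c b = (A *v b) \<bullet> b" for b
  have c: "c (axis i 1) = A $ i $ i" for i
    by (simp add: c_def inner_axis matrix_vector_mult_basis column_def)
  have A: "(*v) A = (\<lambda>x. 0 + (\<Sum>j\<in>Basis. (c j * (x \<bullet> j)) *\<^sub>R j))"
  proof (intro ext)
    fix x
    have "(A *v x) $ i = A $ i $ i * x $ i" for i
    proof -
      have "(A *v x) $ i = (\<Sum>j\<in>UNIV. if j = i then A $ i $ i * x $ i else 0)"
        unfolding matrix_vector_mult_def vec_lambda_beta using 3(1)[of i] by (intro sum.cong) auto
      then show ?thesis
        by simp
    qed
    moreover have "(\<Sum>j\<in>Basis. (c j * (x \<bullet> j)) *\<^sub>R j) $ i = A $ i $ i * x $ i" for i
    proof -
      have "(\<Sum>j\<in>Basis. (c j * (x \<bullet> j)) *\<^sub>R j) $ i = (\<Sum>k\<in>UNIV. A $ k $ k * x $ k * (axis k 1 $ i))"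
        by (simp add: Basis_cart sum.reindex c inner_axis)
      also have "\<dots> = (\<Sum>k\<in>UNIV. if k = i then A $ i $ i * x $ i else 0)"
        by (intro sum.cong) (auto simp: axis_def)
      finally show ?thesis
        by simp
    qed
    ultimately show "A *v x = 0 + (\<Sum>j\<in>Basis. (c j * (x \<bullet> j)) *\<^sub>R j)"
      by (simp add: vec_eq_iff)
  qed
  have "(\<Prod>b\<in>Basis. \<bar>c b\<bar>) = \<bar>det A\<bar>"
    by (simp add: Basis_cart prod.reindex c det abs_prod)
  moreover have "c b \<noteq> 0" if "b \<in> Basis" for b
    using that nz by (auto simp: Basis_cart c)
  ultimately have lborel: "lborel = density (distr lborel borel ((*v) A)) (\<lambda>_. ennreal \<bar>det A\<bar>)"
    unfolding A using lborel_affine_euclidean[of c 0] by simp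
  have "(\<integral>\<^sup>+x. g x \<partial>lborel) =
      (\<integral>\<^sup>+x. g x \<partial>density (distr lborel borel ((*v) A)) (\<lambda>_. ennreal \<bar>det A\<bar>))"
    by (simp only: lborel[symmetric])
  also have "\<dots> = (\<integral>\<^sup>+x. ennreal \<bar>det A\<bar> * g x \<partial>distr lborel borel ((*v) A))"
    by (rule nn_integral_density) simp_all
  also have "\<dots> = ennreal \<bar>det A\<bar> * (\<integral>\<^sup>+x. g (A *v x) \<partial>lborel)"
    by (simp add: nn_integral_distr nn_integral_cmult)
  finally show ?case .
next
  case (4 m n)
  let ?A = "(\<chi> i j. mat 1 $ i $ Transposition.transpose m n j) :: real^'n^'n"
  have "\<bar>det ?A\<bar> = 1"
    by (simp add: det_permute_columns permutes_swap_id sign_swap_id abs_mult)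
  moreover have "?A *v x = (\<chi> i. x $ Transposition.transpose m n i)" for x
  proof -
    have "(?A *v x) $ i = (\<Sum>j\<in>UNIV. if j = Transposition.transpose m n i then x $ j else 0)" for i
      unfolding matrix_vector_mult_def vec_lambda_beta by (intro sum.cong) (auto simp: mat_def)
    then show ?thesis
      by (simp add: vec_eq_iff)
  qed
  ultimately show ?case
    using nn_integral_lborel_swap[OF 4(3)] by simp
next
  \<comment> \<open>This elementary matrix is a shear along \<open>axis m 1\<close> whose
    displacement depends only on coordinate \<open>n\<close>. Since \<open>m\<close> and
    \<open>n\<close> differ, moving along the shear direction leaves the displacement
    unchanged.\<close>
  case (5 m n c)
  let ?A = "(\<chi> i j. if i = m \<and> j = n then c else of_bool (i = j)) :: real^'n^'n"
  have [measurable]: "g \<in> borel_measurable borel" by fact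
  have "?A = (\<chi> k. if k = m then row m (mat 1) + c *s row n (mat 1) else row k (mat 1))"
    using 5(1) by (auto simp: vec_eq_iff row_def mat_def)
  then have "det ?A = 1"
    using det_row_operation[OF 5(1), where A="mat 1" and c=c] by simp
  moreover have "?A *v x = x + (c * x $ n) *\<^sub>R axis m 1" for x
  proof -
    have "(?A *v x) $ i = (\<Sum>j\<in>UNIV. (if j = i then x $ j else 0) +
        (if j = n then (if i = m then c * x $ j else 0) else 0))" for i
      unfolding matrix_vector_mult_def vec_lambda_beta using 5(1) by (intro sum.cong) auto
    then show ?thesis
      by (simp add: vec_eq_iff sum.distrib axis_def)
  qed
  moreover have "axis m (1::real) $ n = 0"
    using 5(1) by (simp add: axis_def)
  then have "(\<integral>\<^sup>+x. g (x + (c * x $ n) *\<^sub>R axis m 1) \<partial>lborel) = (\<integral>\<^sup>+x. g x \<partial>lborel)"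
    by (intro nn_integral_lborel_shear)
      (auto simp: Basis_cart intro!: borel_measurable_continuous_onI continuous_intros)
  ultimately show ?case
    by simp
qed

section \<open>Gaussian integrals by congruence to the identity\<close>

lemma inner_matrix_vector_mult: "v \<bullet> (A *v w) = (transpose A *v v) \<bullet> w" for A :: "real^'n^'m"
  by (simp add: dot_lmul_matrix transpose_matrix_vector)

text \<open>Gram-Schmidt for the inner product \<open>x \<bullet> (A *v y)\<close>: the columns of
  \<open>P\<close> are a basis orthonormal for this form. The vectors are built by induction over
  sets of indices, ending with all of them.\<close>

lemma ex_orthonormal_congruence:
  fixes A :: "real^'n^'n"
  assumes A: "sym_pos_def A"
  shows "\<exists>P :: real^'n^'n. transpose P ** A ** P = mat 1"
proof -
  have sym: "x \<bullet> (A *v y) = y \<bullet> (A *v x)" for x y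
    by (metis A dot_lmul_matrix inner_commute sym_pos_def_def transpose_matrix_vector)
  have "\<exists>v. \<forall>i\<in>S. \<forall>j\<in>S. v i \<bullet> (A *v v j) = (if i = j then 1 else 0)" for S :: "'n set"
  proof -
    have "finite S" by simp
    then show ?thesis
    proof induction
      case empty
      then show ?case by simp
    next
      case (insert k S)
      then obtain v where v: "\<And>i j. i \<in> S \<Longrightarrow> j \<in> S \<Longrightarrow> v i \<bullet> (A *v v j) = (if i = j then 1 else 0)"
        by blast
      \<comment> \<open>As \<open>k\<close> lies outside \<open>S\<close>, there are fewer than the
        full number of vectors \<open>A *v v j\<close>, so some nonzero \<open>x\<close> is
        orthogonal to all of them. It is the next direction, up to normalisation in the norm given
        by \<open>A\<close>.\<close>
      have "dim ((\<lambda>j. A *v v j) ` S) \<le> card S"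
        by (meson card_image_le dim_le_card' finite finite_imageI le_trans)
      also have "\<dots> < DIM(real^'n)"
        using insert psubset_card_mono[of UNIV S] by auto
      finally obtain x where x: "x \<noteq> 0" "\<And>y. y \<in> span ((\<lambda>j. A *v v j) ` S) \<Longrightarrow> orthogonal x y"
        using orthogonal_to_subspace_exists by blast
      define a where "a = x \<bullet> (A *v x)"
      have a: "0 < a"
        using A x(1) by (simp add: a_def sym_pos_def_def)
      define w where "w = x /\<^sub>R sqrt a"
      have w: "w \<bullet> (A *v v j) = 0" if "j \<in> S" for j
        using x(2)[of "A *v v j"] that by (simp add: w_def orthogonal_def span_base)
      then have w': "v j \<bullet> (A *v w) = 0" if "j \<in> S" for j
        using that sym by metis
      have "w \<bullet> (A *v w) = 1"
        using a by (simp add: w_def matrix_vector_mult_scaleR field_simps flip: a_def)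
      then show ?case
        using v w w' insert.hyps by (intro exI[of _ "v(k := w)"]) auto
    qed
  qed
  from this[of UNIV] obtain v :: "'n \<Rightarrow> real^'n" where v: "\<And>i j. v i \<bullet> (A *v v j) = (if i = j then 1 else 0)"
    by (metis UNIV_I)
  define P where "P = transpose (\<chi> i. v i)"
  have P: "P *v axis j 1 = v j" for j
    by (simp add: P_def matrix_vector_mult_basis column_def row_def transpose_def vec_eq_iff)
  have "(transpose P ** A ** P) $ i $ j = mat 1 $ i $ j" for i j
  proof -
    have "(transpose P ** A ** P) $ i $ j = axis i 1 \<bullet> ((transpose P ** A ** P) *v axis j 1)"
      by (simp add: inner_axis' matrix_vector_mult_basis column_def)
    also have "\<dots> = v i \<bullet> (A *v v j)"
      by (simp only: matrix_vector_mul_assoc[symmetric] inner_matrix_vector_mult[of _ "transpose P"] transpose_transpose P)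
    finally show ?thesis
      by (simp add: v mat_def)
  qed
  then show ?thesis
    unfolding vec_eq_iff by blast
qed

text \<open>The integrand is a product over coordinates, each factor being an unnormalised standard
  normal density.\<close>

lemma nn_integral_std_gaussian:
  "(\<integral>\<^sup>+(x::'a::euclidean_space). ennreal (exp (- 1/2 * (x \<bullet> x))) \<partial>lborel) = ennreal (sqrt (2 * pi) ^ DIM('a))"
proof -
  have 1: "(\<integral>\<^sup>+x. ennreal (exp (- 1/2 * (x * x))) \<partial>lborel) = ennreal (sqrt (2 * pi))"
  proof -
    have "(\<lambda>x. ennreal (exp (- 1/2 * (x * x)))) = (\<lambda>x. ennreal (sqrt (2 * pi)) * ennreal (std_normal_density x))"
      by (auto simp: std_normal_density_def ennreal_mult[symmetric] power2_eq_square field_simps)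
    then show ?thesis
      by (simp add: nn_integral_cmult nn_integral_eq_integral)
  qed
  have "(\<integral>\<^sup>+(x::'a). ennreal (exp (- 1/2 * (x \<bullet> x))) \<partial>lborel) =
      (\<integral>\<^sup>+(x::'a). (\<Prod>b\<in>Basis. ennreal (exp (- 1/2 * ((x \<bullet> b) * (x \<bullet> b))))) \<partial>lborel)"
    by (subst euclidean_inner) (simp add: prod_ennreal exp_sum sum_distrib_left flip: sum_negf)
  also have "\<dots> = ennreal (sqrt (2 * pi) ^ DIM('a))"
    by (subst nn_integral_lborel_prod) (use 1 in \<open>simp_all add: ennreal_power\<close>)
  finally show ?thesis .
qed

text \<open>Taking determinants of the congruence gives
  \<open>det A * (det P)\<^sup>2 = 1\<close>.\<close>

lemma orthonormal_congruence_det: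
  assumes "transpose P ** A ** P = (mat 1 :: real^'n^'n)"
  shows "det P \<noteq> 0" "\<bar>det P\<bar> = 1 / sqrt (det A)" "0 < det A"
proof -
  have *: "det A * (det P)\<^sup>2 = 1"
    using arg_cong[OF assms, of det] by (simp add: det_mul power2_eq_square algebra_simps)
  then show P: "det P \<noteq> 0" by auto
  then show A: "0 < det A"
    by (metis "*" zero_less_mult_pos2 zero_less_one zero_less_power2)
  have "sqrt (det A) * \<bar>det P\<bar> = 1"
    using arg_cong[OF *, of sqrt] by (simp add: real_sqrt_mult)
  then show "\<bar>det P\<bar> = 1 / sqrt (det A)"
    using A by (simp add: field_simps)
qed

text \<open>After translating \<open>a\<close> to the origin, substituting \<open>P *v x\<close>
  turns the quadratic form into \<open>x \<bullet> x\<close>; the factor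
  \<open>\<bar>det P\<bar>\<close> contributes the determinant of \<open>A\<close>.\<close>

lemma nn_integral_gaussian:
  fixes A :: "real^'n^'n"
  assumes "sym_pos_def A"
  shows "(\<integral>\<^sup>+x. ennreal (exp (- 1/2 * ((x - a) \<bullet> (A *v (x - a))))) \<partial>lborel) =
    ennreal (sqrt ((2 * pi) ^ CARD('n) / det A))"
proof -
  obtain P :: "real^'n^'n" where P: "transpose P ** A ** P = mat 1"
    using ex_orthonormal_congruence[OF assms] by blast
  note det = orthonormal_congruence_det[OF P]
  have quad: "(P *v x) \<bullet> (A *v (P *v x)) = x \<bullet> x" for x
  proof -
    have "x \<bullet> x = x \<bullet> ((transpose P ** A ** P) *v x)"
      by (simp add: P)
    also have "\<dots> = (P *v x) \<bullet> (A *v (P *v x))"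
      by (simp only: matrix_vector_mul_assoc[symmetric] inner_matrix_vector_mult[of _ "transpose P"] transpose_transpose)
    finally show ?thesis by simp
  qed
  define g where "g x = ennreal (exp (- 1/2 * (x \<bullet> (A *v x))))" for x
  have g [measurable]: "g \<in> borel_measurable borel"
  proof -
    have "(\<lambda>x. exp (- 1/2 * (x \<bullet> (A *v x)))) \<in> borel_measurable borel"
      by (intro borel_measurable_continuous_onI continuous_intros)
    then show ?thesis
      unfolding g_def by (rule measurable_compose[OF _ measurable_ennreal])
  qed
  have "(\<integral>\<^sup>+x. g x \<partial>lborel) = (\<integral>\<^sup>+x. g x \<partial>distr lborel borel ((+) (-a)))"
    by (simp only: lborel_distr_plus)
  also have "\<dots> = (\<integral>\<^sup>+x. g (x - a) \<partial>lborel)"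
    by (subst nn_integral_distr) simp_all
  finally have "(\<integral>\<^sup>+x. g (x - a) \<partial>lborel) = ennreal \<bar>det P\<bar> * (\<integral>\<^sup>+x. g (P *v x) \<partial>lborel)"
    using nn_integral_lborel_linear[OF det(1) g] by simp
  also have "\<dots> = ennreal \<bar>det P\<bar> * ennreal (sqrt (2 * pi) ^ CARD('n))"
    unfolding g_def quad by (subst nn_integral_std_gaussian) simp
  also have "\<dots> = ennreal (sqrt ((2 * pi) ^ CARD('n) / det A))"
    by (simp only: det(2) real_sqrt_divide real_sqrt_power ennreal_mult[symmetric]) (use det(3) in \<open>simp add: ennreal_mult'[symmetric]\<close>)
  finally show ?thesis
    by (simp add: g_def)
qed

section \<open>Gibbs variational principle\<close>

text \<open>For positive \<open>p\<close> this is ln t \<le> t - 1 at t = g / p, scaled by -p, with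
  equality only at t = 1. For \<open>p = 0\<close> it reads -g \<le> 0, and equality is excluded by
  \<open>0 < g\<close>.\<close>

lemma gibbs_pointwise:
  fixes p g :: real
  assumes "0 \<le> p" "0 < g"
  shows "p - g \<le> p * (ln p - ln g)"
    and "p * (ln p - ln g) = p - g \<Longrightarrow> p = g"
proof -
  have "p - g \<le> p * (ln p - ln g) \<and> (p * (ln p - ln g) = p - g \<longrightarrow> p = g)"
  proof (cases "p = 0")
    case True
    then show ?thesis using assms by simp
  next
    case False
    with assms have p: "0 < p" by simp
    have eq: "p * (ln p - ln g) = - (p * ln (g / p))" "p - g = - (p * (g / p - 1))"
      using p assms by (simp_all add: ln_div algebra_simps)
    have "ln (g / p) \<le> g / p - 1"
      using p assms by (intro ln_le_minus_one) simp
    moreover have "p = g" if "ln (g / p) = g / p - 1"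
      using ln_eq_minus_one[OF _ that] p assms by simp
    ultimately show ?thesis
      unfolding eq using p by auto
  qed
  then show "p - g \<le> p * (ln p - ln g)" "p * (ln p - ln g) = p - g \<Longrightarrow> p = g"
    by auto
qed

lemma prob_densities_integral:
  assumes "\<pi> \<in> prob_densities"
  shows "integrable lborel \<pi>" "(\<integral>u. \<pi> u \<partial>lborel) = 1"
proof -
  have [measurable]: "\<pi> \<in> borel_measurable lborel" and nn: "\<And>u. 0 \<le> \<pi> u"
    and 1: "(\<integral>\<^sup>+u. ennreal (\<pi> u) \<partial>lborel) = 1"
    using assms by (auto simp: prob_densities_def)
  show int: "integrable lborel \<pi>"
    by (rule integrableI_nonneg) (auto simp: nn 1)
  show "(\<integral>u. \<pi> u \<partial>lborel) = 1"
    by (subst integral_eq_nn_integral) (auto simp: nn 1)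
qed

text \<open>A competing density may have an objective that is not integrable. The integrable
  minorant \<open>L\<close> keeps the negative part finite, so the extended integral is either the
  ordinary integral or infinity. In the first case equality of the integrals forces
  \<open>h - L\<close>, which is nonnegative, to vanish almost everywhere; in the second the premise
  of the equality claim fails.\<close>

lemma ext_integral_lower_bound:
  fixes h L :: "'a \<Rightarrow> real"
  assumes [measurable]: "h \<in> borel_measurable M" and L: "integrable M L"
    and le: "\<And>u. L u \<le> h u"
  shows "ereal (\<integral>u. L u \<partial>M) \<le> ext_integral M h"
    and "ext_integral M h \<le> ereal (\<integral>u. L u \<partial>M) \<Longrightarrow> AE u in M. h u = L u"
proof -
  have "ereal (\<integral>u. L u \<partial>M) \<le> ext_integral M h \<and>
    (ext_integral M h \<le> ereal (\<integral>u. L u \<partial>M) \<longrightarrow> (AE u in M. h u = L u))"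
  proof (cases "integrable M h")
    case True
    note h = this
    have "(\<integral>u. L u \<partial>M) \<le> (\<integral>u. h u \<partial>M)"
      using L h le by (intro integral_mono) auto
    moreover have "AE u in M. h u = L u" if "(\<integral>u. h u \<partial>M) \<le> (\<integral>u. L u \<partial>M)"
    proof -
      have "(\<integral>u. h u - L u \<partial>M) = 0"
        using calculation that L h by simp
      then have "AE u in M. h u - L u = 0"
        using L h le by (subst (asm) integral_nonneg_eq_0_iff_AE) auto
      then show ?thesis by simp
    qed
    ultimately show ?thesis
      using ext_integral_eq_lebesgue_integral[OF h] by simp
  next
    case False
    have "(\<integral>\<^sup>+u. ennreal (- h u) \<partial>M) \<le> (\<integral>\<^sup>+u. ennreal (- L u) \<partial>M)"
      using le by (intro nn_integral_mono ennreal_leI) simp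
    also have "\<dots> < \<infinity>"
      using L by (auto simp: real_integrable_def less_top)
    finally have neg: "(\<integral>\<^sup>+u. ennreal (- h u) \<partial>M) < \<infinity>" .
    with False have pos: "(\<integral>\<^sup>+u. ennreal (h u) \<partial>M) = \<infinity>"
      by (auto simp: real_integrable_def)
    obtain r where r: "0 \<le> r" "(\<integral>\<^sup>+u. ennreal (- h u) \<partial>M) = ennreal r"
      using neg by (cases "\<integral>\<^sup>+u. ennreal (- h u) \<partial>M") auto
    have "ext_integral M h = \<infinity>"
      unfolding ext_integral_def pos r(2) using r(1) by (simp add: enn2ereal_ennreal)
    then show ?thesis by simp
  qed
  then show "ereal (\<integral>u. L u \<partial>M) \<le> ext_integral M h"
    "ext_integral M h \<le> ereal (\<integral>u. L u \<partial>M) \<Longrightarrow> AE u in M. h u = L u"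
    by auto
qed

text \<open>The hypothesis on \<open>q\<close> says that \<open>g\<close> is the Boltzmann density
  exp ((c - q) / \<alpha>), with \<open>c\<close> fixed by normalisation. The excess of the
  objective over \<open>c\<close> is then \<alpha> times the relative entropy of
  \<open>\<pi>\<close> with respect to \<open>g\<close>.\<close>

lemma gibbs_variational:
  assumes "\<alpha> > 0" and g: "g \<in> prob_densities" and pos: "\<And>u. 0 < g u"
    and q: "\<And>u. q u = c - \<alpha> * ln (g u)"
  shows "max_ent_objective \<alpha> q g = ereal c"
    and "\<pi> \<in> prob_densities \<Longrightarrow> ereal c \<le> max_ent_objective \<alpha> q \<pi>"
    and "\<pi> \<in> prob_densities \<Longrightarrow> max_ent_objective \<alpha> q \<pi> \<le> ereal c \<Longrightarrow> AE u in lborel. \<pi> u = g u"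
proof -
  have "(\<lambda>u. g u * (q u + \<alpha> * ln (g u))) = (\<lambda>u. c * g u)"
    by (simp add: q mult.commute)
  then show "max_ent_objective \<alpha> q g = ereal c"
    unfolding max_ent_objective_def
    by (simp add: ext_integral_eq_lebesgue_integral prob_densities_integral[OF g])
next
  assume \<pi>: "\<pi> \<in> prob_densities"
  define h where "h = (\<lambda>u. \<pi> u * (q u + \<alpha> * ln (\<pi> u)))"
  \<comment> \<open>The minorant comes from the pointwise Gibbs inequality. Both densities have mass
    one, so its second summand integrates to zero and the whole to \<open>c\<close>.\<close>
  define L where "L = (\<lambda>u. c * \<pi> u + \<alpha> * (\<pi> u - g u))"
  have [measurable]: "\<pi> \<in> borel_measurable borel" "g \<in> borel_measurable borel"
    and nn: "0 \<le> \<pi> u" for u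
    using \<pi> g by (auto simp: prob_densities_def)
  have "q \<in> borel_measurable borel"
    unfolding q[abs_def] by measurable
  then have meas: "h \<in> borel_measurable lborel"
    unfolding h_def by measurable
  have L: "integrable lborel L" "(\<integral>u. L u \<partial>lborel) = c"
    unfolding L_def using prob_densities_integral[OF \<pi>] prob_densities_integral[OF g] by simp_all
  have h: "h u = c * \<pi> u + \<alpha> * (\<pi> u * (ln (\<pi> u) - ln (g u)))" for u
    by (simp add: h_def q algebra_simps)
  have le: "L u \<le> h u" for u
    unfolding h L_def using gibbs_pointwise(1)[OF nn pos] \<open>\<alpha> > 0\<close> by simp
  have eq: "\<pi> u = g u" if "h u = L u" for u
    using that gibbs_pointwise(2)[OF nn pos] \<open>\<alpha> > 0\<close> unfolding h L_def by simp
  show "ereal c \<le> max_ent_objective \<alpha> q \<pi>"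
    using ext_integral_lower_bound(1)[OF meas L(1) le] by (simp add: L max_ent_objective_def h_def)
  show "AE u in lborel. \<pi> u = g u" if "max_ent_objective \<alpha> q \<pi> \<le> ereal c"
  proof -
    have "AE u in lborel. h u = L u"
      using that by (intro ext_integral_lower_bound(2)[OF meas L(1) le])
        (simp add: L max_ent_objective_def h_def)
    then show ?thesis
      by eventually_elim (rule eq)
  qed
qed

section \<open>The Gaussian policy as a maximum entropy optimum\<close>

lemma sym_pos_def_det_pos: "sym_pos_def A \<Longrightarrow> 0 < det A"
  using ex_orthonormal_congruence orthonormal_congruence_det(3) by blast

lemma det_scaleR: "det (c *\<^sub>R A) = c ^ CARD('n) * det A" for A :: "real^'n^'n"
proof -
  have "c *\<^sub>R A = mat c ** A"
    by (simp add: vec_eq_iff matrix_matrix_mult_def mat_def if_distrib[of "\<lambda>a. a * _"] cong: if_cong)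
  then show ?thesis
    by (simp add: det_mul det_diagonal mat_def)
qed

lemma scaleR_matrix_mult: "(c *\<^sub>R A) ** (d *\<^sub>R B) = (c * d) *\<^sub>R (A ** B)" for A :: "real^'n^'m"
  by (simp add: vec_eq_iff matrix_matrix_mult_def sum_distrib_left mult_ac)

lemma uminus_matrix_vector_mult: "(- A) *v x = - (A *v x)" for A :: "real^'n^'m"
  by (simp add: vec_eq_iff matrix_vector_mult_def sum_negf)

lemma matrix_vector_mult_uminus: "A *v (- x) = - (A *v x)" for A :: "real^'n^'m"
  by (simp add: vec_eq_iff matrix_vector_mult_def sum_negf)

lemma matrix_inv_unique:
  fixes A :: "real^'n^'n"
  assumes "A ** B = mat 1" "B ** A = mat 1"
  shows "matrix_inv A = B"
proof -
  have "A ** matrix_inv A = mat 1 \<and> matrix_inv A ** A = mat 1"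
    unfolding matrix_inv_def using assms by (intro someI) blast
  then show ?thesis
    by (metis assms(2) matrix_mul_assoc matrix_mul_lid matrix_mul_rid)
qed

context
  fixes \<alpha> :: real and Q :: "real^'m^'m"
  assumes \<alpha>: "0 < \<alpha>" and Q: "sym_pos_def Q"
begin

lemma matrix_inv_mult: "matrix_inv Q ** Q = mat 1" "Q ** matrix_inv Q = mat 1"
proof -
  have "invertible Q"
    using sym_pos_def_det_pos[OF Q] by (simp add: invertible_det_nz)
  then obtain B where "Q ** B = mat 1" "B ** Q = mat 1"
    by (auto simp: invertible_def)
  then show "matrix_inv Q ** Q = mat 1" "Q ** matrix_inv Q = mat 1"
    using matrix_inv_unique[of Q B] by simp_all
qed

text \<open>The covariance has inverse \<open>(1 / \<alpha>) *\<^sub>R Q\<close> and determinant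
  \<open>\<alpha> ^ CARD('m) / det Q\<close>, which removes all matrix inverses from the
  formula.\<close>

lemma gaussian_density_eq:
  "gaussian_density \<mu> (\<alpha> *\<^sub>R matrix_inv Q) u =
    exp (- 1/2 * ((u - \<mu>) \<bullet> ((1 / \<alpha>) *\<^sub>R Q *v (u - \<mu>)))) / sqrt ((2 * pi * \<alpha>) ^ CARD('m) / det Q)"
proof -
  have "matrix_inv (\<alpha> *\<^sub>R matrix_inv Q) = (1 / \<alpha>) *\<^sub>R Q"
    using \<alpha> by (intro matrix_inv_unique)
      (simp_all add: matrix_inv_mult scaleR_matrix_mult)
  moreover have "det (matrix_inv Q) = 1 / det Q"
    using arg_cong[OF matrix_inv_mult(1), of det] sym_pos_def_det_pos[OF Q]
    by (simp add: det_mul field_simps)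
  ultimately show ?thesis
    by (simp add: gaussian_density_def det_scaleR power_mult_distrib)
qed

lemma gaussian_density_pos: "0 < gaussian_density \<mu> (\<alpha> *\<^sub>R matrix_inv Q) u"
  unfolding gaussian_density_eq using \<alpha> sym_pos_def_det_pos[OF Q] by simp

text \<open>The additive constant, multiplied by \<alpha>, becomes the entropy term
  \<open>V\<^sub>H\<close> of the value function.\<close>

lemma ln_gaussian_density:
  "ln (gaussian_density \<mu> (\<alpha> *\<^sub>R matrix_inv Q) u) =
    - 1 / (2 * \<alpha>) * ((u - \<mu>) \<bullet> (Q *v (u - \<mu>))) + 1/2 * (ln (det Q) - real CARD('m) * ln (2 * pi * \<alpha>))"
proof -
  define Z where "Z = sqrt ((2 * pi * \<alpha>) ^ CARD('m) / det Q)"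
  have det: "0 < det Q"
    by (rule sym_pos_def_det_pos[OF Q])
  then have Z: "0 < Z"
    using \<alpha> by (simp add: Z_def)
  have ln_Z: "ln Z = 1/2 * (real CARD('m) * ln (2 * pi * \<alpha>) - ln (det Q))"
    unfolding Z_def using \<alpha> det
    by (subst ln_sqrt) (simp_all add: ln_div ln_realpow del: power_mult_distrib)
  show ?thesis
    unfolding gaussian_density_eq Z_def[symmetric] using Z
    by (subst ln_div) (simp_all add: ln_Z scaleR_matrix_vector_assoc[symmetric] algebra_simps)
qed

lemma gaussian_density_in_prob_densities:
  "gaussian_density \<mu> (\<alpha> *\<^sub>R matrix_inv Q) \<in> prob_densities"
proof -
  \<comment> \<open>\<open>A\<close> is the inverse covariance. The Gaussian integral for
    \<open>A\<close> equals the normaliser \<open>Z\<close>, because \<open>det A\<close> is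
    \<open>det Q\<close> divided by \<open>\<alpha> ^ CARD('m)\<close>.\<close>
  define A where "A = (1 / \<alpha>) *\<^sub>R Q"
  define Z where "Z = sqrt ((2 * pi * \<alpha>) ^ CARD('m) / det Q)"
  have Z: "0 < Z"
    unfolding Z_def using \<alpha> sym_pos_def_det_pos[OF Q] by simp
  have A: "sym_pos_def A"
    using \<alpha> Q by (auto simp: A_def sym_pos_def_def transpose_def vec_eq_iff
        scaleR_matrix_vector_assoc[symmetric])
  have eq: "gaussian_density \<mu> (\<alpha> *\<^sub>R matrix_inv Q) =
      (\<lambda>u. exp (- 1/2 * ((u - \<mu>) \<bullet> (A *v (u - \<mu>)))) / Z)"
    by (simp add: fun_eq_iff gaussian_density_eq A_def Z_def)
  have [measurable]: "(\<lambda>u. exp (- 1/2 * ((u - \<mu>) \<bullet> (A *v (u - \<mu>))))) \<in> borel_measurable borel"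
    by (intro borel_measurable_continuous_onI continuous_intros
        linear_continuous_on_compose[OF _ matrix_vector_mul_linear])
  have "(\<integral>\<^sup>+u. ennreal (exp (- 1/2 * ((u - \<mu>) \<bullet> (A *v (u - \<mu>)))) / Z) \<partial>lborel) =
      (\<integral>\<^sup>+u. ennreal (exp (- 1/2 * ((u - \<mu>) \<bullet> (A *v (u - \<mu>))))) * ennreal (1 / Z) \<partial>lborel)"
    using Z by (simp add: ennreal_mult[symmetric])
  also have "\<dots> = ennreal (sqrt ((2 * pi) ^ CARD('m) / det A)) * ennreal (1 / Z)"
    by (subst nn_integral_multc) (simp_all only: nn_integral_gaussian[OF A], measurable)
  also have "sqrt ((2 * pi) ^ CARD('m) / det A) = Z"
    using \<alpha> by (simp add: A_def Z_def det_scaleR power_mult_distrib power_divide)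
  also have "ennreal Z * ennreal (1 / Z) = 1"
    using Z by (simp add: ennreal_mult[symmetric])
  finally have "(\<integral>\<^sup>+u. ennreal (exp (- 1/2 * ((u - \<mu>) \<bullet> (A *v (u - \<mu>)))) / Z) \<partial>lborel) = 1" .
  moreover have "(\<lambda>u. exp (- 1/2 * ((u - \<mu>) \<bullet> (A *v (u - \<mu>)))) / Z) \<in> borel_measurable borel"
    by measurable
  ultimately show ?thesis
    unfolding prob_densities_def eq using Z by (auto intro: less_imp_le)
qed

text \<open>With the square completed, \<open>q\<close> and \<open>- \<alpha> * ln (g u)\<close>
  have the same quadratic part, so they differ by the constant \<open>c\<close> and the Gibbs
  principle applies.\<close>

lemma max_ent_quadratic:
  fixes q :: "real^'m \<Rightarrow> real"
  assumes q: "\<And>u. q u = m + 1/2 * ((u - \<mu>) \<bullet> (Q *v (u - \<mu>)))"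
  defines "g \<equiv> gaussian_density \<mu> (\<alpha> *\<^sub>R matrix_inv Q)"
    and "c \<equiv> m + \<alpha> / 2 * (ln (det Q) - real CARD('m) * ln (2 * pi * \<alpha>))"
  shows "optimal_density \<alpha> q g"
    and "optimal_density \<alpha> q \<pi> \<Longrightarrow> AE u in lborel. \<pi> u = g u"
    and "(INF \<pi>\<in>prob_densities. max_ent_objective \<alpha> q \<pi>) = ereal c"
proof -
  have g: "g \<in> prob_densities"
    unfolding g_def by (rule gaussian_density_in_prob_densities)
  have "q u = c - \<alpha> * ln (g u)" for u
    unfolding g_def c_def ln_gaussian_density q using \<alpha> by (simp add: field_simps)
  note var = gibbs_variational[OF \<alpha> g gaussian_density_pos[of \<mu>, folded g_def] this]
  show "optimal_density \<alpha> q g"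
    using g var(1,2) by (simp add: optimal_density_def)
  \<comment> \<open>An optimal \<open>\<pi>\<close> does no worse than \<open>g\<close>, so its
    objective is at most \<open>c\<close>, the equality case of the Gibbs principle.\<close>
  show "AE u in lborel. \<pi> u = g u" if "optimal_density \<alpha> q \<pi>"
    using that g var(1) var(3)[of \<pi>] by (auto simp: optimal_density_def)
  show "(INF \<pi>\<in>prob_densities. max_ent_objective \<alpha> q \<pi>) = ereal c"
    using g var(1,2) by (intro antisym INF_greatest) (auto intro: INF_lower2)
qed

end

section \<open>Completing the square and the value function\<close>

text \<open>The equation \<open>Q *v \<mu> = - b\<close> makes \<mu> the stationary point, where the
  left-hand side takes the value \<open>1/2 * (b \<bullet> \<mu>)\<close>. Symmetry of
  \<open>Q\<close> matches the cross terms.\<close>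

lemma complete_square:
  fixes Q :: "real^'m^'m" and b \<mu> u :: "real^'m"
  assumes "transpose Q = Q" and "Q *v \<mu> = - b"
  shows "b \<bullet> u + 1/2 * (u \<bullet> (Q *v u)) = 1/2 * (b \<bullet> \<mu>) + 1/2 * ((u - \<mu>) \<bullet> (Q *v (u - \<mu>)))"
proof -
  have "\<mu> \<bullet> (Q *v u) = (Q *v \<mu>) \<bullet> u"
    using inner_matrix_vector_mult[of \<mu> Q u] assms(1) by simp
  then show ?thesis
    using assms(2) by (simp add: matrix_vector_mult_diff_distrib inner_diff_left inner_diff_right
        inner_commute algebra_simps)
qed

theorem lemma2:
  fixes f :: "real^'n \<Rightarrow> real^'m \<Rightarrow> real^'n" and l :: "real^'n \<Rightarrow> real^'m \<Rightarrow> real"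
    and V' :: "real^'n \<Rightarrow> real" and V :: "real^'n \<Rightarrow> ereal"
    and xb :: "real^'n" and ub :: "real^'m" and \<alpha> :: real
    and Q\<^sub>x :: "real^'n" and Q\<^sub>u :: "real^'m"
    and Q\<^sub>x\<^sub>x :: "real^'n^'n" and Q\<^sub>u\<^sub>x :: "real^'n^'m" and Q\<^sub>u\<^sub>u :: "real^'m^'m"
    and K :: "real^'n^'m" and k :: "real^'m" and \<mu> :: "real^'n \<Rightarrow> real^'m"
    and Vbar V\<^sub>H :: real and V\<^sub>x :: "real^'n" and V\<^sub>x\<^sub>x :: "real^'n^'n"
  assumes "\<alpha> > 0"
    and "(\<lambda>(x, u). f x u) differentiable (at (xb, ub))"
    and "twice_differentiable_at (\<lambda>(x, u). l x u) (xb, ub)"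
    and "quadratic_around V' (f xb ub)"
    and "Q\<^sub>x = Qx f l V' xb ub" and "Q\<^sub>u = Qu f l V' xb ub"
    and "Q\<^sub>x\<^sub>x = Qxx f l V' xb ub" and "Q\<^sub>u\<^sub>x = Qux f l V' xb ub" and "Q\<^sub>u\<^sub>u = Quu f l V' xb ub"
    and "sym_pos_def Q\<^sub>u\<^sub>u"
    and "V = max_ent_value f l V' xb ub \<alpha>"
    and "K = - (matrix_inv Q\<^sub>u\<^sub>u ** Q\<^sub>u\<^sub>x)" and "k = - (matrix_inv Q\<^sub>u\<^sub>u *v Q\<^sub>u)"
    and "\<mu> = (\<lambda>dx. - (matrix_inv Q\<^sub>u\<^sub>u *v (Q\<^sub>u\<^sub>x *v dx + Q\<^sub>u)))"
    and "Vbar = V' (f xb ub) + l xb ub - 1/2 * (Q\<^sub>u \<bullet> (matrix_inv Q\<^sub>u\<^sub>u *v Q\<^sub>u))"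
    and "V\<^sub>H = \<alpha> / 2 * (ln (det Q\<^sub>u\<^sub>u) - real CARD('m) * ln (2 * pi * \<alpha>))"
    and "V\<^sub>x = Q\<^sub>x + transpose K *v (Q\<^sub>u\<^sub>u *v k) + transpose K *v Q\<^sub>u + transpose Q\<^sub>u\<^sub>x *v k"
    and "V\<^sub>x\<^sub>x = Q\<^sub>x\<^sub>x + transpose K ** Q\<^sub>u\<^sub>u ** K + transpose K ** Q\<^sub>u\<^sub>x + transpose Q\<^sub>u\<^sub>x ** K"
  shows "(\<forall>dx. optimal_density \<alpha> (Qhat f l V' xb ub dx)
                 (gaussian_density (\<mu> dx) (\<alpha> *\<^sub>R matrix_inv Q\<^sub>u\<^sub>u))) \<and>
    (\<forall>dx \<pi>. optimal_density \<alpha> (Qhat f l V' xb ub dx) \<pi> \<longrightarrow>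
       (AE u in lborel. \<pi> u = gaussian_density (\<mu> dx) (\<alpha> *\<^sub>R matrix_inv Q\<^sub>u\<^sub>u) u)) \<and>
    (\<forall>dx. \<mu> dx = K *v dx + k) \<and>
    (\<forall>x. V x = ereal (Vbar + V\<^sub>H + V\<^sub>x \<bullet> (x - xb) + 1/2 * ((x - xb) \<bullet> (V\<^sub>x\<^sub>x *v (x - xb)))))"
proof -
  have Q: "transpose Q\<^sub>u\<^sub>u = Q\<^sub>u\<^sub>u"
    using assms(10) by (simp add: sym_pos_def_def)
  note inv = matrix_inv_mult[OF assms(1,10)]
  have \<mu>: "\<mu> dx = K *v dx + k" for dx
    unfolding assms(12-14)
    by (simp add: matrix_vector_mul_assoc[symmetric] matrix_vector_right_distrib uminus_matrix_vector_mult)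
  have K: "Q\<^sub>u\<^sub>u *v (K *v dx) = - (Q\<^sub>u\<^sub>x *v dx)" for dx
    unfolding assms(12)
    by (simp add: uminus_matrix_vector_mult matrix_vector_mult_uminus matrix_vector_mul_assoc matrix_mul_assoc inv)
  have k: "Q\<^sub>u\<^sub>u *v k = - Q\<^sub>u"
    unfolding assms(13) by (simp add: matrix_vector_mult_uminus matrix_vector_mul_assoc inv)
  \<comment> \<open>\<open>m dx\<close> is the minimum of the quadratic model over the control,
    attained at \<open>\<mu> dx\<close>; the last summand is the constant left by completing the
    square.\<close>
  define m where "m dx = V' (f xb ub) + l xb ub + Q\<^sub>x \<bullet> dx + 1/2 * (dx \<bullet> (Q\<^sub>x\<^sub>x *v dx))
      + 1/2 * ((Q\<^sub>u\<^sub>x *v dx + Q\<^sub>u) \<bullet> \<mu> dx)" for dx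
  have Qhat: "Qhat f l V' xb ub dx du = m dx + 1/2 * ((du - \<mu> dx) \<bullet> (Q\<^sub>u\<^sub>u *v (du - \<mu> dx)))" for dx du
  proof -
    have "Q\<^sub>u\<^sub>u *v \<mu> dx = - (Q\<^sub>u\<^sub>x *v dx + Q\<^sub>u)"
      by (simp add: \<mu> matrix_vector_right_distrib K k)
    from complete_square[OF Q this, of du] show ?thesis
      unfolding Qhat_def assms(5-9)[symmetric] m_def
      by (simp add: inner_add_left inner_add_right inner_commute algebra_simps del: matrix_vector_mult_diff_distrib)
  qed
  have m: "m dx = Vbar + V\<^sub>x \<bullet> dx + 1/2 * (dx \<bullet> (V\<^sub>x\<^sub>x *v dx))" for dx
  proof -
    \<comment> \<open>Since \<open>Q\<^sub>u\<^sub>u *v k = - Q\<^sub>u\<close>, the two terms with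
      \<open>transpose K\<close> cancel. The same happens in \<open>V\<^sub>x\<^sub>x\<close> below
      through the identity \<open>K\<close>.\<close>
    have "V\<^sub>x = Q\<^sub>x + transpose Q\<^sub>u\<^sub>x *v k"
      unfolding assms(17) k by (simp add: matrix_vector_mult_uminus)
    then have Vx: "V\<^sub>x \<bullet> dx = Q\<^sub>x \<bullet> dx + k \<bullet> (Q\<^sub>u\<^sub>x *v dx)"
      by (simp add: inner_add_left inner_matrix_vector_mult)
    have "V\<^sub>x\<^sub>x *v dx = Q\<^sub>x\<^sub>x *v dx + transpose Q\<^sub>u\<^sub>x *v (K *v dx)"
      unfolding assms(18)
      by (simp add: matrix_vector_mult_add_rdistrib matrix_vector_mul_assoc[symmetric] K matrix_vector_mult_uminus)
    then have Vxx: "dx \<bullet> (V\<^sub>x\<^sub>x *v dx) = dx \<bullet> (Q\<^sub>x\<^sub>x *v dx) + (Q\<^sub>u\<^sub>x *v dx) \<bullet> (K *v dx)"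
      by (simp add: inner_add_right inner_matrix_vector_mult[of dx "transpose Q\<^sub>u\<^sub>x"]
          del: transpose_matrix_vector)
    \<comment> \<open>Symmetry of \<open>Q\<^sub>u\<^sub>u\<close> makes the two mixed terms of
      \<open>(Q\<^sub>u\<^sub>x *v dx + Q\<^sub>u) \<bullet> \<mu> dx\<close> equal, so with the
      factor 1/2 they add up to the single term \<open>k \<bullet> (Q\<^sub>u\<^sub>x *v dx)\<close>
      of \<open>V\<^sub>x \<bullet> dx\<close>.\<close>
    have "Q\<^sub>u \<bullet> (K *v dx) = - ((Q\<^sub>u\<^sub>u *v k) \<bullet> (K *v dx))"
      by (simp add: k)
    also have "(Q\<^sub>u\<^sub>u *v k) \<bullet> (K *v dx) = k \<bullet> (Q\<^sub>u\<^sub>u *v (K *v dx))"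
      using inner_matrix_vector_mult[of k Q\<^sub>u\<^sub>u] Q by simp
    finally have "Q\<^sub>u \<bullet> (K *v dx) = k \<bullet> (Q\<^sub>u\<^sub>x *v dx)"
      by (simp add: K)
    then show ?thesis
      unfolding m_def \<mu> Vx Vxx assms(15)
      by (simp add: inner_add_left inner_add_right inner_commute assms(13) algebra_simps)
  qed
  note max_ent = max_ent_quadratic[OF assms(1,10) Qhat]
  have "V x = ereal (Vbar + V\<^sub>H + V\<^sub>x \<bullet> (x - xb) + 1/2 * ((x - xb) \<bullet> (V\<^sub>x\<^sub>x *v (x - xb))))" for x
    unfolding assms(11) max_ent_value_def max_ent(3) m assms(16) by (simp only: add_ac)
  then show ?thesis
    using max_ent(1,2) \<mu> by blast
qed

end
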